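(* Let $B$ be a Bernstein subset of $\mathbb{R}$ that is a subgroup of $(\mathbb{R},+)$, and let $\mathcal{B}=\mathbb{R}/B=\{B+x:x\in\mathbb{R}\}$. If $U\in\mathcal{S}(\mathcal{B})$, then $U$ is a Bernstein subset of $\mathbb{R}$. Consequently, $\mathcal{S}(\mathcal{B})$ consists of sets which are not Lebesgue measurable and which do not have the Baire property in $\mathbb{R}$.
   Context: A Bernstein set is a subset $B\subseteq\mathbb{R}$ such that $B\cap F\neq\emptyset$ and $(\mathbb{R}\setminus B)\cap F\neq\emptyset$ for every uncountable closed $F\subseteq\mathbb{R}$. $\mathcal{S}(\mathcal{B})=\{\bigcup_{i=1}^n B_i: B_i\in\mathcal{B}, n\in\mathbb{N}\}$ (with $n\ge 1$) is the family of all finite unions of elements of $\mathcal{B}$. A set $A\subseteq\mathbb{R}$ has the Baire property if $A=O\,\Delta\, M$ with $O$ open and $M$ meager. *)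

theory Defs
  imports "HOL-Analysis.Analysis" "HOL-Algebra.Coset"
begin

definition bernstein_set :: "real set \<Rightarrow> bool" where
  "bernstein_set B \<longleftrightarrow>
     (\<forall>F. closed F \<and> uncountable F \<longrightarrow> B \<inter> F \<noteq> {} \<and> (UNIV - B) \<inter> F \<noteq> {})"

definition real_add_group :: "real monoid" where
  "real_add_group = \<lparr>carrier = UNIV, mult = (+), one = 0\<rparr>"

(* The condition n >= 1 keeps out the empty union. *)
definition finite_unions :: "'a set set \<Rightarrow> 'a set set" where
  "finite_unions \<A> = {(\<Union>i\<in>{1..n}. A i) | (n::nat) A. n \<ge> 1 \<and> (\<forall>i\<in>{1..n}. A i \<in> \<A>)}"

definition nowhere_dense :: "'a::topological_space set \<Rightarrow> bool" where
  "nowhere_dense N \<longleftrightarrow> interior (closure N) = {}"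

definition meager :: "'a::topological_space set \<Rightarrow> bool" where
  "meager M \<longleftrightarrow> (\<exists>N::nat \<Rightarrow> 'a set. (\<forall>n. nowhere_dense (N n)) \<and> M = (\<Union>n. N n))"

definition has_baire_property :: "'a::topological_space set \<Rightarrow> bool" where
  "has_baire_property A \<longleftrightarrow> (\<exists>O' M. open O' \<and> meager M \<and> A = sym_diff O' M)"

end

theory Submission
  imports Defs
begin

text \<open>A proper subgroup \<open>B\<close> of \<open>\<real>\<close> has infinite index, because \<open>\<real>\<close> is divisible. Hence a finite union
  \<open>U\<close> of cosets contains one coset and misses another one; both are translates of \<open>B\<close>, so both meet
  every uncountable closed set, and \<open>U\<close> is a Bernstein set. If a Bernstein set were Lebesgue measurable,
  then by inner regularity it and its complement would both have finite measure. If it had the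
  Baire property, then it or its complement would contain \<open>O - M\<close> with \<open>O\<close> nonempty open and \<open>M\<close> meager;
  but a Cantor scheme produces an uncountable closed subset of \<open>O - M\<close>.\<close>

section \<open>Subgroups, cosets and finite unions in additive notation\<close>

lemma subgroup_real_add_group_iff:
  "subgroup B real_add_group \<longleftrightarrow> 0 \<in> B \<and> (\<forall>a\<in>B. \<forall>b\<in>B. a + b \<in> B) \<and> (\<forall>a\<in>B. - a \<in> B)"
proof -
  have "inv\<^bsub>real_add_group\<^esub> a = - a" for a
    unfolding m_inv_def real_add_group_def by (rule the_equality) auto
  then show ?thesis
    by (auto simp: subgroup_def real_add_group_def)
qed

lemma rcosets_real_add_group: "rcosets\<^bsub>real_add_group\<^esub> B = range (\<lambda>x. (+) x ` B)"
  by (auto simp: RCOSETS_def r_coset_def real_add_group_def image_def add.commute)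

text \<open>Trades the enumeration by \<open>{1..n}\<close> for an arbitrary finite index set of
  representatives; \<open>n \<ge> 1\<close> becomes \<open>X \<noteq> {}\<close>.\<close>

lemma finite_unions_range_iff:
  "U \<in> finite_unions (range f) \<longleftrightarrow> (\<exists>X. finite X \<and> X \<noteq> {} \<and> U = (\<Union>x\<in>X. f x))"
proof
  assume "U \<in> finite_unions (range f)"
  then obtain n A where nA: "U = (\<Union>i\<in>{1..n}. A i)" "n \<ge> (1::nat)" "\<forall>i\<in>{1..n}. A i \<in> range f"
    unfolding finite_unions_def by blast
  from nA(3) have "\<forall>i\<in>{1..n}. \<exists>x. A i = f x"
    by blast
  then obtain g where "\<forall>i\<in>{1..n}. A i = f (g i)"
    by metis
  with nA show "\<exists>X. finite X \<and> X \<noteq> {} \<and> U = (\<Union>x\<in>X. f x)"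
    by (intro exI[of _ "g ` {1..n}"]) auto
next
  assume "\<exists>X. finite X \<and> X \<noteq> {} \<and> U = (\<Union>x\<in>X. f x)"
  then obtain X where X: "finite X" "X \<noteq> {}" "U = (\<Union>x\<in>X. f x)"
    by blast
  then obtain g where g: "bij_betw g {1..card X} X"
    using ex_bij_betw_nat_finite_1 by blast
  have "g ` {1..card X} = X"
    using g by (rule bij_betw_imp_surj_on)
  then have "U = (\<Union>i\<in>{1..card X}. f (g i))"
    using X(3) by (metis image_image)
  moreover have "card X \<ge> 1"
    using X(1,2) by (simp add: Suc_le_eq card_gt_0_iff)
  ultimately show "U \<in> finite_unions (range f)"
    unfolding finite_unions_def
    by (intro CollectI exI[of _ "card X"] exI[of _ "\<lambda>i. f (g i)"]) simp
qed

section \<open>Subgroups of finite index\<close>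

lemma subgroup_nat_mult:
  assumes "subgroup B real_add_group" "x \<in> B"
  shows "real n * x \<in> B"
  using assms by (induction n) (auto simp: subgroup_real_add_group_iff algebra_simps)

lemma subgroup_diff:
  assumes "subgroup B real_add_group" "x \<in> B" "y \<in> B"
  shows "x - y \<in> B"
  using assms unfolding subgroup_real_add_group_iff by (metis diff_conv_add_uminus)

text \<open>By the pigeonhole principle two of the points \<open>j * y / n!\<close>, \<open>0 \<le> j \<le> n\<close>, lie in the same one of \<open>n\<close>
  cosets; their difference is \<open>d * y / n!\<close> with \<open>1 \<le> d \<le> n\<close>, and \<open>d\<close> divides \<open>n!\<close>.\<close>

lemma subgroup_finite_index_eq_UNIV:
  assumes B: "subgroup B real_add_group" and "finite X" and cover: "(\<Union>x\<in>X. (+) x ` B) = UNIV"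
  shows "B = UNIV"
proof -
  have "y \<in> B" for y
  proof -
    define n where "n = card X"
    define z where "z j = real j * (y / fact n)" for j
    have "\<exists>x\<in>X. z j - x \<in> B" for j
    proof -
      have "z j \<in> (\<Union>x\<in>X. (+) x ` B)"
        unfolding cover by simp
      then show ?thesis
        by (auto intro!: bexI)
    qed
    then obtain f where f: "f j \<in> X" "z j - f j \<in> B" for j
      by metis
    have "card (f ` {0..n}) \<le> n"
      unfolding n_def using \<open>finite X\<close> f(1) by (intro card_mono) auto
    then have "\<not> inj_on f {0..n}"
      by (auto dest: card_image)
    then obtain i j where ij: "i < j" "j \<le> n" "f i = f j"
      by (metis (mono_tags) atLeastAtMost_iff linorder_inj_onI')
    have "z j - z i \<in> B"
      using subgroup_diff[OF B f(2)[of j] f(2)[of i]] ij by simp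
    then have *: "real (j - i) * (y / fact n) \<in> B"
      using ij by (simp add: z_def of_nat_diff algebra_simps)
    have "(j - i) dvd fact n"
      using ij by (intro dvd_fact) auto
    then obtain k where k: "fact n = (j - i) * k" ..
    have "real k * (real (j - i) * (y / fact n)) \<in> B"
      by (intro subgroup_nat_mult B *)
    also have "real k * (real (j - i) * (y / fact n)) = real ((j - i) * k) * (y / fact n)"
      by simp
    also have "\<dots> = y"
      unfolding k[symmetric] by simp
    finally show "y \<in> B" .
  qed
  then show ?thesis by blast
qed

section \<open>Translates and finite unions of cosets\<close>

lemma bernstein_set_translate:
  assumes "bernstein_set B"
  shows "bernstein_set ((+) x ` B)"
  unfolding bernstein_set_def
proof (intro allI impI)
  fix F :: "real set"
  assume F: "closed F \<and> uncountable F"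
  have "closed ((+) (- x) ` F)"
    using F closed_translation by blast
  moreover have "uncountable ((+) (- x) ` F)"
    using F countable_image_inj_eq[of "(+) (- x)" F] by simp
  ultimately obtain a b where "a \<in> F" "- x + a \<in> B" "b \<in> F" "- x + b \<notin> B"
    using assms unfolding bernstein_set_def by blast
  then have "a \<in> (+) x ` B \<inter> F" "b \<in> (UNIV - (+) x ` B) \<inter> F"
    using image_eqI[of a "(+) x" "- x + a" B] by auto
  then show "(+) x ` B \<inter> F \<noteq> {} \<and> (UNIV - (+) x ` B) \<inter> F \<noteq> {}"
    by blast
qed

lemma bernstein_set_finite_union_cosets:
  assumes B: "bernstein_set B" "subgroup B real_add_group" and X: "finite X" "X \<noteq> {}"
  shows "bernstein_set (\<Union>x\<in>X. (+) x ` B)" (is "bernstein_set ?U")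
proof -
  \<comment> \<open>The whole line is itself an uncountable closed set, so the complement of
    \<open>B\<close> meets it.\<close>
  have "B \<noteq> UNIV"
    using B(1) uncountable_UNIV_real unfolding bernstein_set_def by force
  then obtain y where y: "y \<notin> ?U"
    using subgroup_finite_index_eq_UNIV[OF B(2) X(1)] by blast
  \<comment> \<open>Since \<open>?U\<close> is a union of full cosets, missing \<open>y\<close>
    means missing the whole coset of \<open>y\<close>.\<close>
  have disjoint: "(+) y ` B \<inter> ?U = {}"
  proof (rule ccontr)
    assume "(+) y ` B \<inter> ?U \<noteq> {}"
    then obtain x b c where xbc: "x \<in> X" "b \<in> B" "c \<in> B" "y + b = x + c"
      by auto
    then have "y = x + (c - b)" "c - b \<in> B"
      using subgroup_diff[OF B(2)] by auto
    with xbc y show False by blast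
  qed
  obtain x where x: "x \<in> X" using X by blast
  show ?thesis
    unfolding bernstein_set_def
  proof (intro allI impI)
    fix F :: "real set"
    assume F: "closed F \<and> uncountable F"
    have "(+) x ` B \<inter> F \<noteq> {}" "(+) y ` B \<inter> F \<noteq> {}"
      using bernstein_set_translate[OF B(1)] F unfolding bernstein_set_def by blast+
    with x disjoint show "?U \<inter> F \<noteq> {} \<and> (UNIV - ?U) \<inter> F \<noteq> {}"
      by blast
  qed
qed

section \<open>Lebesgue measurability\<close>

lemma bernstein_set_Compl: "bernstein_set B \<Longrightarrow> bernstein_set (- B)"
  unfolding bernstein_set_def by blast

text \<open>A closed subset of \<open>U\<close> misses the complement of \<open>U\<close>, so it is
  countable and hence null. Inner approximation by a closed set up to an error below 1 therefore
  bounds the measure of \<open>U\<close> itself.\<close>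

lemma bernstein_set_emeasure_less_1:
  assumes "bernstein_set U" "U \<in> sets lebesgue"
  shows "emeasure lebesgue U < 1"
proof -
  obtain T where T: "closed T" "T \<subseteq> U" "U - T \<in> lmeasurable" "emeasure lebesgue (U - T) < ennreal 1"
    using sets_lebesgue_inner_closed[OF assms(2), of 1] by auto
  have "countable T"
    using assms(1) T unfolding bernstein_set_def by blast
  then have null: "T \<in> null_sets lebesgue"
    using countable_imp_null_set_lborel null_sets_completionI by blast
  have "emeasure lebesgue (U - T) = emeasure lebesgue U"
    using null assms(2) by (intro emeasure_Diff_null_set) auto
  with T(4) show ?thesis by simp
qed

lemma bernstein_set_not_measurable:
  assumes "bernstein_set U"
  shows "U \<notin> sets lebesgue"
proof
  assume U: "U \<in> sets lebesgue"
  then have C: "- U \<in> sets lebesgue"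
    using sets.compl_sets[OF U] by (simp add: Compl_eq_Diff_UNIV)
  have "emeasure lebesgue (U \<union> - U) \<le> emeasure lebesgue U + emeasure lebesgue (- U)"
    using U C by (rule emeasure_subadditive)
  also have "\<dots> < \<infinity>"
    using bernstein_set_emeasure_less_1[OF assms U]
      bernstein_set_emeasure_less_1[OF bernstein_set_Compl[OF assms] C]
    by (metis ennreal_add_less_top ennreal_one_less_top infinity_ennreal_def order.strict_trans)
  finally show False
    by simp
qed

section \<open>Cantor schemes and the Baire property\<close>

lemma Cantor_scheme_step:
  fixes K N :: "'a::{heine_borel,perfect_space} set"
  assumes "interior K \<noteq> {}" "nowhere_dense N"
  shows "\<exists>L. (\<forall>b::bool. compact (L b) \<and> interior (L b) \<noteq> {} \<and> L b \<subseteq> K - N) \<and> L True \<inter> L False = {}"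
proof -
  \<comment> \<open>This open set is nonempty because \<open>closure N\<close> has empty interior,
    and it has a second point because no singleton is open in a perfect space. Small closed balls
    around two of its points are the sets sought.\<close>
  define W where "W = interior K - closure N"
  have W: "open W"
    by (simp add: W_def open_Diff)
  have "\<not> interior K \<subseteq> closure N"
    using assms interior_maximal[of "interior K" "closure N"] unfolding nowhere_dense_def by auto
  then obtain x where x: "x \<in> W"
    by (auto simp: W_def)
  moreover have "W \<noteq> {x}"
    using W not_open_singleton[of x] by blast
  ultimately obtain y where y: "y \<in> W" "y \<noteq> x"
    by blast
  obtain d where d: "d > 0" "cball x d \<subseteq> W" "cball y d \<subseteq> W"
  proof -
    obtain d1 d2 where "d1 > 0" "cball x d1 \<subseteq> W" "d2 > 0" "cball y d2 \<subseteq> W"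
      using W x y open_contains_cball by metis
    then show thesis
      by (intro that[of "min d1 d2"]) auto
  qed
  define e where "e = min d (dist x y / 3)"
  have e: "0 < e" "e \<le> d" "e \<le> dist x y / 3"
    using d y by (auto simp: e_def)
  have "W \<subseteq> K - N"
    using interior_subset closure_subset unfolding W_def by blast
  then have sub: "cball z e \<subseteq> K - N" if "z = x \<or> z = y" for z
    using that d e subset_cball[of e d] by blast
  have int: "interior (cball z e) \<noteq> {}" for z :: 'a
    using e ball_subset_cball[of z e] interior_maximal[OF ball_subset_cball open_ball, of z e] by force
  have "cball x e \<inter> cball y e = {}"
  proof (rule ccontr)
    assume "cball x e \<inter> cball y e \<noteq> {}"
    then obtain z where "dist x z \<le> e" "dist y z \<le> e"
      by auto
    then have "dist x y \<le> e + e"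
      using dist_triangle2[of x y z] by simp
    with e show False
      by auto
  qed
  with sub int show ?thesis
    by (intro exI[of _ "\<lambda>b. cball (if b then x else y) e"]) auto
qed

lemma uncountable_nat_set_UNIV: "uncountable (UNIV :: nat set set)"
  using Cantors_theorem[of "UNIV :: nat set"] by (simp add: uncountable_def)

text \<open>Build a binary tree of compact sets inside \<open>V\<close> whose level
  \<open>n + 1\<close> avoids \<open>N n\<close> and whose siblings are disjoint. Each infinite
  branch has a common point, and distinct branches have distinct points.\<close>

lemma uncountable_closed_subset_open_minus_meager:
  fixes V M :: "'a::{heine_borel,perfect_space} set"
  assumes "open V" "V \<noteq> {}" "meager M"
  shows "\<exists>F. closed F \<and> uncountable F \<and> F \<subseteq> V - M"
proof -
  obtain N where N: "\<And>n::nat. nowhere_dense (N n)" and M: "M = (\<Union>n. N n)"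
    using assms(3) unfolding meager_def by blast
  \<comment> \<open>A splitting step with nothing to avoid supplies the compact root of the
    tree.\<close>
  obtain K0 where K0: "compact K0" "interior K0 \<noteq> {}" "K0 \<subseteq> V"
    using Cantor_scheme_step[of V "{}"] assms unfolding nowhere_dense_def
    by (metis Diff_empty closure_empty interior_empty interior_open)
  define split where "split X n L \<longleftrightarrow>
      (\<forall>b::bool. compact (L b) \<and> interior (L b) \<noteq> {} \<and> L b \<subseteq> X - N n) \<and> L True \<inter> L False = {}"
    for X n L
  have ex: "\<exists>L. split X n L" if "interior X \<noteq> {}" for X n
    using Cantor_scheme_step[OF that N[of n]] unfolding split_def .
  define P where "P n X = (SOME L. split X n L)" for n X
  have split: "split X n (P n X)" if "interior X \<noteq> {}" for n X
    using someI_ex[OF ex[OF that]] unfolding P_def .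
  have P: "compact (P n X b) \<and> interior (P n X b) \<noteq> {} \<and> P n X b \<subseteq> X - N n"
    and P_disjoint: "P n X True \<inter> P n X False = {}" if "interior X \<noteq> {}" for n X b
    using split[OF that, of n] by (simp_all add: split_def)
  \<comment> \<open>Nodes are bit lists with the newest bit at the head, so the tail is the parent
    and its length selects the \<open>N n\<close> to avoid.\<close>
  define K where "K = rec_list K0 (\<lambda>b s X. P (length s) X b)"
  have K_Nil: "K [] = K0" and K_Cons: "K (b # s) = P (length s) (K s) b" for b s
    by (simp_all add: K_def)
  have K: "compact (K s) \<and> interior (K s) \<noteq> {}" for s
    by (induction s) (use K0 P in \<open>auto simp: K_Nil K_Cons\<close>)
  have K_sub: "K (b # s) \<subseteq> K s - N (length s)" for b s
    using P K by (simp add: K_Cons)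
  \<comment> \<open>Each level is a finite union of compact sets, which makes the intersection
    closed.\<close>
  define F where "F = (\<Inter>n. \<Union>s\<in>{s. length s = n}. K s)"
  have "closed F"
  proof -
    have "finite {s::bool list. length s = n}" for n
      using finite_lists_length_eq[of "UNIV :: bool set" n] by simp
    then show ?thesis
      unfolding F_def by (intro closed_INT ballI closed_UN) (use K compact_imp_closed in auto)
  qed
  moreover have "F \<subseteq> V - M"
  proof
    fix x assume "x \<in> F"
    then have level: "\<exists>s. length s = n \<and> x \<in> K s" for n
      by (auto simp: F_def)
    have "x \<in> V"
      using level[of 0] K0 K_Nil by auto
    moreover have "x \<notin> N n" for n
    proof -
      obtain b s where "length s = n" "x \<in> K (b # s)"
        using level[of "Suc n"] by (metis length_Suc_conv)
      then show ?thesis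
        using K_sub by blast
    qed
    ultimately show "x \<in> V - M"
      by (simp add: M)
  qed
  moreover have "uncountable F"
  proof
    \<comment> \<open>The first \<open>n\<close> bits of the characteristic function of
      \<open>A\<close>, reversed to match the order of bits in the nodes of
      \<open>K\<close>.\<close>
    define branch where "branch A n = rev (map (\<lambda>i. i \<in> A) [0..<n])" for A :: "nat set" and n
    have branch_Suc: "branch A (Suc n) = (n \<in> A) # branch A n" for A n
      by (simp add: branch_def)
    have length_branch: "length (branch A n) = n" for A n
      by (simp add: branch_def)
    have "\<exists>x. \<forall>n. x \<in> K (branch A n)" for A
    proof -
      have "decseq (\<lambda>n. K (branch A n))"
        using K_sub by (intro decseq_SucI) (auto simp: branch_Suc)
      then have "(\<Inter>n. K (branch A n)) \<noteq> {}"
        using K by (intro compact_nest) (auto simp: decseq_def, metis interior_empty)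
      then show ?thesis
        by blast
    qed
    then obtain x where x: "\<And>A n. x A \<in> K (branch A n)"
      by metis
    have "inj x"
    proof (rule injI, rule ccontr)
      fix A A' assume eq: "x A = x A'" and "A \<noteq> A'"
      then have "\<exists>n. (n \<in> A) \<noteq> (n \<in> A')"
        by blast
      \<comment> \<open>Up to the first difference \<open>n\<close> both branches reach the same
        node; then they enter its two disjoint children, which cannot share a point.\<close>
      then obtain n where n: "(n \<in> A) \<noteq> (n \<in> A')" and least: "\<And>i. i < n \<Longrightarrow> (i \<in> A) = (i \<in> A')"
        using exists_least_iff[of "\<lambda>n. (n \<in> A) \<noteq> (n \<in> A')"] by auto
      have "branch A n = branch A' n"
        using least by (simp add: branch_def)
      then have "x A \<in> P n (K (branch A n)) (n \<in> A) \<inter> P n (K (branch A n)) (n \<in> A')"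
        using x[of A "Suc n"] x[of A' "Suc n"] eq by (simp add: branch_Suc K_Cons length_branch)
      with n P_disjoint[of "K (branch A n)" n] K show False
        by (cases "n \<in> A") auto
    qed
    moreover have "range x \<subseteq> F"
      using x length_branch unfolding F_def by blast
    moreover assume "countable F"
    ultimately have "countable (UNIV :: nat set set)"
      using countable_subset countable_image_inj_on by blast
    then show False
      using uncountable_nat_set_UNIV by blast
  qed
  ultimately show ?thesis
    by blast
qed

lemma bernstein_set_not_baire_property:
  assumes "bernstein_set U"
  shows "\<not> has_baire_property U"
proof
  assume "has_baire_property U"
  then obtain V M where V: "open V" and M: "meager M" and U: "U = sym_diff V M"
    unfolding has_baire_property_def by blast
  show False
  proof (cases "V = {}")
    case True
    \<comment> \<open>Here \<open>U = M\<close>, so \<open>F\<close> misses \<open>U\<close>; in the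
      other case \<open>F\<close> lies in \<open>U\<close> and misses its complement.\<close>
    obtain F where "closed F" "uncountable F" "F \<subseteq> UNIV - M"
      using uncountable_closed_subset_open_minus_meager[of UNIV M] M by auto
    with True U assms show False
      unfolding bernstein_set_def by blast
  next
    case False
    then obtain F where "closed F" "uncountable F" "F \<subseteq> V - M"
      using uncountable_closed_subset_open_minus_meager[of V M] V M by blast
    with U assms show False
      unfolding bernstein_set_def by blast
  qed
qed

theorem lemma3p1:
  fixes B :: "real set"
  assumes "bernstein_set B"
    and "subgroup B real_add_group"
  shows "(\<forall>U \<in> finite_unions (rcosets\<^bsub>real_add_group\<^esub> B). bernstein_set U) \<and>
         (\<forall>U \<in> finite_unions (rcosets\<^bsub>real_add_group\<^esub> B).
            U \<notin> sets lebesgue \<and> \<not> has_baire_property U)"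
proof -
  have "bernstein_set U" if "U \<in> finite_unions (rcosets\<^bsub>real_add_group\<^esub> B)" for U
    using that bernstein_set_finite_union_cosets[OF assms]
    unfolding rcosets_real_add_group finite_unions_range_iff by blast
  then show ?thesis
    using bernstein_set_not_measurable bernstein_set_not_baire_property by blast
qed

end
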